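(* Let $f:\mathbb{R}^p\to\mathbb{R}$ be smooth (continuously differentiable), let $\theta:\mathbb{R}^p\to]-\infty,\infty]$ be proper and lower semicontinuous, let $\nu>0$, let $h(x):=\nu\|x\|_0$ for $x\in\mathbb{R}^p$, and let $\Theta:=f+\theta+h$. Suppose that the following conditions hold: (i) $\theta$ is continuous relative to the set ${\rm dom}\,\partial\theta$; (ii) $\theta$ is regular at every point of ${\rm dom}\,\partial\theta$; (iii) for every $x\in{\rm dom}\,\partial\theta$, $\partial(\theta+h)(x)\subseteq\partial\theta(x)+\partial h(x)$; (iv) for every $I\subseteq\{1,\ldots,p\}$, the function $g_I:=f_I+\theta_I$ is a KL function of exponent $1/2$, where $f_I(z):=f(E_Iz)$ and $\theta_I(z):=\theta(E_Iz)$ for $z\in\mathbb{R}^{|I|}$. Then $\Theta$ has the KL property of exponent $1/2$ at every critical point of $\Theta$.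
   Context: $\|x\|_0$ denotes the number of nonzero entries of $x$. $E$ is the $p\times p$ identity matrix and $E_I$ is the $p\times|I|$ matrix consisting of the columns of $E$ indexed by $I$, so that $E_Iz$ is the vector of $\mathbb{R}^p$ whose entries on $I$ are given by $z$ and which is zero off $I$. Subdifferentials. For $\phi:\mathbb{R}^p\to]-\infty,\infty]$ and $x\in{\rm dom}\,\phi:=\{x:\phi(x)<\infty\}$, the regular subdifferential $\widehat{\partial}\phi(x)$ is the set of $v\in\mathbb{R}^p$ with $\liminf_{x'\to x,\,x'\neq x}\frac{\phi(x')-\phi(x)-\langle v,x'-x\rangle}{\|x'-x\|}\ge 0$. The (limiting) subdifferential $\partial\phi(x)$ is the set of all $v$ for which there are $x^k\to x$ with $\phi(x^k)\to\phi(x)$ and $v^k\in\widehat{\partial}\phi(x^k)$ with $v^k\to v$. For $x\notin{\rm dom}\,\phi$ these sets are empty. ${\rm dom}\,\partial\phi:=\{x:\partial\phi(x)\neq\emptyset\}$. A critical point of $\phi$ is a point $\overline{x}$ with $0\in\partial\phi(\overline{x})$. Regularity of a function at a point is subdifferential (Clarke) regularity in the sense of Rockafellar and Wets, i.e. the epigraph is Clarke regular at the corresponding point. KL property of exponent $1/2$. A function $\phi:\mathbb{R}^m\to]-\infty,\infty]$ has the Kurdyka-Łojasiewicz (KL) property of exponent $1/2$ at $\overline{x}\in{\rm dom}\,\partial\phi$ if there exist $c>0$, $\eta\in]0,\infty]$ and a neighborhood $\mathcal{U}$ of $\overline{x}$ such that, with $\varphi(s)=c\sqrt{s}$, $\varphi'(\phi(x)-\phi(\overline{x}))\,{\rm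 dist}(0,\partial\phi(x))\ge 1$ for all $x\in\mathcal{U}$ with $\phi(\overline{x})<\phi(x)<\phi(\overline{x})+\eta$, where ${\rm dist}(0,\emptyset)=\infty$. It is a KL function of exponent $1/2$ if it has this property at each point of ${\rm dom}\,\partial\phi$ (a vacuous condition if $\phi\equiv\infty$). *)

theory Defs
  imports "HOL-Analysis.Analysis"
begin

section \<open>Subdifferentials\<close>

text \<open>
  The statement needs variational analysis on \<open>\<real>\<^sup>p\<close> and on all the spaces \<open>\<real>\<^bsup>|I|\<^esup>\<close>
  with \<open>I\<close> ranging over the subsets of the coordinates. As this range cannot be expressed by types,
  the notions below take a carrier \<open>S\<close>, meant to be a linear subspace of the ambient type and regarded
  as a Euclidean space in its own right with the induced inner product. Points, perturbations
  and subgradients all range over \<open>S\<close>, and values of the function outside \<open>S\<close> are irrelevant.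
  For \<open>S = UNIV\<close> these are the usual notions. The lemma \<open>KL_half_function_on_isometry\<close> below shows that
  replacing a Euclidean space by an isometric linear subspace is harmless.

  Functions into \<open>]-\<infinity>, \<infinity>]\<close> are functions into \<^typ>\<open>ereal\<close> that avoid \<open>-\<infinity>\<close>.
\<close>

definition effdom_on :: "'a set \<Rightarrow> ('a \<Rightarrow> ereal) \<Rightarrow> 'a set" where
  "effdom_on S \<phi> = {x \<in> S. \<phi> x < \<infinity>}"

definition rsubdiff_on :: "'a::euclidean_space set \<Rightarrow> ('a \<Rightarrow> ereal) \<Rightarrow> 'a \<Rightarrow> 'a set" where
  "rsubdiff_on S \<phi> x =
    (if x \<in> effdom_on S \<phi>
     then {v \<in> S. 0 \<le> Liminf (at x within S)
              (\<lambda>x'. (\<phi> x' - \<phi> x - ereal (v \<bullet> (x' - x))) / ereal (norm (x' - x)))}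
     else {})"

definition subdiff_on :: "'a::euclidean_space set \<Rightarrow> ('a \<Rightarrow> ereal) \<Rightarrow> 'a \<Rightarrow> 'a set" where
  "subdiff_on S \<phi> x =
    (if x \<in> effdom_on S \<phi>
     then {v \<in> S. \<exists>X V. (\<forall>k::nat. X k \<in> S \<and> V k \<in> rsubdiff_on S \<phi> (X k)) \<and>
              X \<longlonglongrightarrow> x \<and> (\<lambda>k. \<phi> (X k)) \<longlonglongrightarrow> \<phi> x \<and> V \<longlonglongrightarrow> v}
     else {})"

definition dom_subdiff_on :: "'a::euclidean_space set \<Rightarrow> ('a \<Rightarrow> ereal) \<Rightarrow> 'a set" where
  "dom_subdiff_on S \<phi> = {x \<in> S. subdiff_on S \<phi> x \<noteq> {}}"

abbreviation subdiff :: "('a::euclidean_space \<Rightarrow> ereal) \<Rightarrow> 'a \<Rightarrow> 'a set" where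
  "subdiff \<equiv> subdiff_on UNIV"

abbreviation dom_subdiff :: "('a::euclidean_space \<Rightarrow> ereal) \<Rightarrow> 'a set" where
  "dom_subdiff \<equiv> dom_subdiff_on UNIV"

definition critical_point :: "('a::euclidean_space \<Rightarrow> ereal) \<Rightarrow> 'a \<Rightarrow> bool" where
  "critical_point \<phi> x \<longleftrightarrow> 0 \<in> subdiff \<phi> x"


section \<open>The Kurdyka-Lojasiewicz property of exponent 1/2\<close>

text \<open>The distance from the origin; unlike \<^const>\<open>infdist\<close>, it is infinite for the empty set.\<close>

definition edist0 :: "'a::real_normed_vector set \<Rightarrow> ereal" where
  "edist0 A = (INF v\<in>A. ereal (norm v))"

definition KL_half_at_on :: "'a::euclidean_space set \<Rightarrow> ('a \<Rightarrow> ereal) \<Rightarrow> 'a \<Rightarrow> bool" where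
  "KL_half_at_on S \<phi> xbar \<longleftrightarrow> xbar \<in> dom_subdiff_on S \<phi> \<and>
    (\<exists>c::real. \<exists>\<eta>::ereal. \<exists>U. c > 0 \<and> \<eta> > 0 \<and> open U \<and> xbar \<in> U \<and>
      (\<forall>x \<in> U \<inter> S. \<phi> xbar < \<phi> x \<and> \<phi> x < \<phi> xbar + \<eta> \<longrightarrow>
         ereal (deriv (\<lambda>s::real. c * sqrt s) (real_of_ereal (\<phi> x - \<phi> xbar)))
           * edist0 (subdiff_on S \<phi> x) \<ge> 1))"

definition KL_half_function_on :: "'a::euclidean_space set \<Rightarrow> ('a \<Rightarrow> ereal) \<Rightarrow> bool" where
  "KL_half_function_on S \<phi> \<longleftrightarrow> (\<forall>x \<in> dom_subdiff_on S \<phi>. KL_half_at_on S \<phi> x)"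

abbreviation KL_half_at :: "('a::euclidean_space \<Rightarrow> ereal) \<Rightarrow> 'a \<Rightarrow> bool" where
  "KL_half_at \<equiv> KL_half_at_on UNIV"


section \<open>Subdifferential regularity\<close>

text \<open>Rockafellar and Wets, Variational Analysis, Definitions 6.3, 6.4 and 7.25.\<close>

definition regular_normals :: "'a::euclidean_space set \<Rightarrow> 'a \<Rightarrow> 'a set" where
  "regular_normals C x =
    (if x \<in> C
     then {v. Limsup (at x within C) (\<lambda>x'. ereal ((v \<bullet> (x' - x)) / norm (x' - x))) \<le> 0}
     else {})"

definition normal_cone :: "'a::euclidean_space set \<Rightarrow> 'a \<Rightarrow> 'a set" where
  "normal_cone C x =
    (if x \<in> C
     then {v. \<exists>X V. (\<forall>k::nat. X k \<in> C \<and> V k \<in> regular_normals C (X k)) \<and>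
              X \<longlonglongrightarrow> x \<and> V \<longlonglongrightarrow> v}
     else {})"

definition locally_closed_at :: "'a::topological_space set \<Rightarrow> 'a \<Rightarrow> bool" where
  "locally_closed_at C x \<longleftrightarrow> (\<exists>V. closed V \<and> x \<in> interior V \<and> closed (C \<inter> V))"

definition Clarke_regular_at :: "'a::euclidean_space set \<Rightarrow> 'a \<Rightarrow> bool" where
  "Clarke_regular_at C x \<longleftrightarrow>
     x \<in> C \<and> locally_closed_at C x \<and> normal_cone C x = regular_normals C x"

definition epi :: "('a \<Rightarrow> ereal) \<Rightarrow> ('a \<times> real) set" where
  "epi \<phi> = {(x, a). \<phi> x \<le> ereal a}"

definition subdiff_regular_at :: "('a::euclidean_space \<Rightarrow> ereal) \<Rightarrow> 'a \<Rightarrow> bool" where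
  "subdiff_regular_at \<phi> x \<longleftrightarrow>
     \<bar>\<phi> x\<bar> \<noteq> \<infinity> \<and> Clarke_regular_at (epi \<phi>) (x, real_of_ereal (\<phi> x))"


section \<open>Assumptions on the data\<close>

definition continuously_differentiable :: "('a::euclidean_space \<Rightarrow> real) \<Rightarrow> bool" where
  "continuously_differentiable f \<longleftrightarrow>
     (\<exists>G. (\<forall>x. GDERIV f x :> G x) \<and> continuous_on UNIV G)"

definition proper :: "('a \<Rightarrow> ereal) \<Rightarrow> bool" where
  "proper \<phi> \<longleftrightarrow> (\<forall>x. \<phi> x \<noteq> -\<infinity>) \<and> (\<exists>x. \<phi> x < \<infinity>)"

definition lower_semicontinuous :: "('a::euclidean_space \<Rightarrow> ereal) \<Rightarrow> bool" where
  "lower_semicontinuous \<phi> \<longleftrightarrow> (\<forall>x. \<phi> x \<le> Liminf (at x) \<phi>)"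


section \<open>Coordinate spaces and the zero norm\<close>

definition l0_norm :: "real ^ 'n \<Rightarrow> nat" where
  "l0_norm x = card {i. x $ i \<noteq> 0}"

text \<open>
  \<open>\<real>\<^bsup>|I|\<^esup>\<close>: vectors with entries indexed by \<open>I\<close>, padded by zeros to an element of the
  ambient type; the padding preserves linear structure and inner products. \<open>E_cols I z\<close> is
  \<open>E\<^sub>I z\<close>, which reads only the entries of \<open>z\<close> on \<open>I\<close>.
\<close>

definition coord_space :: "'n set \<Rightarrow> (real ^ 'n) set" where
  "coord_space I = {z. \<forall>i. i \<notin> I \<longrightarrow> z $ i = 0}"

definition E_cols :: "'n set \<Rightarrow> real ^ 'n \<Rightarrow> real ^ 'n" where
  "E_cols I z = (\<chi> i. if i \<in> I then z $ i else 0)"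


section \<open>Invariance under linear isometries\<close>

context
  fixes T :: "'b::euclidean_space \<Rightarrow> 'a::euclidean_space"
  assumes lin: "linear T" and iso: "\<And>x. norm (T x) = norm x"
begin

private lemma inner_T: "T x \<bullet> T y = x \<bullet> y"
proof -
  have "norm (T x + T y) = norm (x + y)"
    by (metis iso lin linear_add)
  then show ?thesis
    by (simp add: dot_norm iso)
qed

private lemma norm_T_diff: "norm (T x - T y) = norm (x - y)"
  by (metis iso lin linear_diff)

private lemma T_eq: "T x = T y \<longleftrightarrow> x = y"
  using norm_T_diff[of x y] by (metis norm_eq_zero right_minus_eq)

private lemma tendsto_T: "(\<lambda>k. T (X k)) \<longlonglongrightarrow> T x \<longleftrightarrow> X \<longlonglongrightarrow> x"
  by (simp add: LIMSEQ_iff norm_T_diff)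

private lemma filtermap_T: "filtermap T (at x) = at (T x) within range T"
proof -
  have "eventually P (filtermap T (at x)) \<longleftrightarrow> eventually P (at (T x) within range T)" for P
    by (auto simp: eventually_filtermap eventually_at dist_norm norm_T_diff T_eq)
  then show ?thesis
    by (simp add: filter_eq_iff)
qed

private lemma rsubdiff_T:
  "rsubdiff_on (range T) \<phi> (T x) = T ` rsubdiff_on UNIV (\<phi> \<circ> T) x"
proof -
  have "Liminf (at (T x) within range T)
          (\<lambda>x'. (\<phi> x' - \<phi> (T x) - ereal (T v \<bullet> (x' - T x))) / ereal (norm (x' - T x)))
      = Liminf (at x)
          (\<lambda>x'. (\<phi> (T x') - \<phi> (T x) - ereal (v \<bullet> (x' - x))) / ereal (norm (x' - x)))" for v
    by (simp add: filtermap_T[symmetric] Liminf_filtermap_eq inj_def T_eq norm_T_diff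
        inner_diff_right inner_T)
  then show ?thesis
    by (auto simp: rsubdiff_on_def effdom_on_def)
qed

private lemma subdiff_T: "subdiff_on (range T) \<phi> (T x) = T ` subdiff (\<phi> \<circ> T) x"
proof -
  have "(\<exists>X V. (\<forall>k::nat. X k \<in> range T \<and> V k \<in> rsubdiff_on (range T) \<phi> (X k)) \<and>
              X \<longlonglongrightarrow> T x \<and> (\<lambda>k. \<phi> (X k)) \<longlonglongrightarrow> \<phi> (T x) \<and> V \<longlonglongrightarrow> T v)
     \<longleftrightarrow> (\<exists>X V. (\<forall>k::nat. V k \<in> rsubdiff_on UNIV (\<phi> \<circ> T) (X k)) \<and>
              X \<longlonglongrightarrow> x \<and> (\<lambda>k. \<phi> (T (X k))) \<longlonglongrightarrow> \<phi> (T x) \<and> V \<longlonglongrightarrow> v)"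
     (is "?L \<longleftrightarrow> ?R") for v
  proof
    assume ?L
    then obtain X V where *: "\<forall>k::nat. X k \<in> range T \<and> V k \<in> rsubdiff_on (range T) \<phi> (X k)"
      "X \<longlonglongrightarrow> T x" "(\<lambda>k. \<phi> (X k)) \<longlonglongrightarrow> \<phi> (T x)" "V \<longlonglongrightarrow> T v"
      by (elim exE conjE)
    have "\<forall>k. \<exists>y. X k = T y"
      using *(1) by blast
    then obtain Y where "\<forall>k. X k = T (Y k)"
      by (rule choice[THEN exE])
    then have Y: "X = (\<lambda>k. T (Y k))"
      by (intro ext) simp
    have "\<forall>k. \<exists>w. w \<in> rsubdiff_on UNIV (\<phi> \<circ> T) (Y k) \<and> V k = T w"
      using *(1) unfolding Y rsubdiff_T by blast
    then obtain W where W: "\<forall>k. W k \<in> rsubdiff_on UNIV (\<phi> \<circ> T) (Y k) \<and> V k = T (W k)"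
      by (rule choice[THEN exE])
    then have "V = (\<lambda>k. T (W k))"
      by (intro ext) simp
    with * Y W show ?R
      by (intro exI[of _ Y] exI[of _ W]) (simp add: tendsto_T)
  next
    assume ?R
    then obtain X V where *: "\<forall>k::nat. V k \<in> rsubdiff_on UNIV (\<phi> \<circ> T) (X k)"
      "X \<longlonglongrightarrow> x" "(\<lambda>k. \<phi> (T (X k))) \<longlonglongrightarrow> \<phi> (T x)" "V \<longlonglongrightarrow> v"
      by (elim exE conjE)
    then show ?L
      by (intro exI[of _ "\<lambda>k. T (X k)"] exI[of _ "\<lambda>k. T (V k)"])
         (simp add: tendsto_T rsubdiff_T)
  qed
  then have mem: "T v \<in> subdiff_on (range T) \<phi> (T x) \<longleftrightarrow> v \<in> subdiff (\<phi> \<circ> T) x" for v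
    by (simp add: subdiff_on_def effdom_on_def)
  have "subdiff_on (range T) \<phi> (T x) \<subseteq> range T"
    by (auto simp: subdiff_on_def)
  with mem show ?thesis by blast
qed

private lemma KL_half_at_T: "KL_half_at_on (range T) \<phi> (T x) \<longleftrightarrow> KL_half_at (\<phi> \<circ> T) x"
proof -
  have d: "edist0 (subdiff_on (range T) \<phi> (T y)) = edist0 (subdiff (\<phi> \<circ> T) y)" for y
    by (simp add: subdiff_T edist0_def image_image iso)
  have dom: "T x \<in> dom_subdiff_on (range T) \<phi> \<longleftrightarrow> x \<in> dom_subdiff (\<phi> \<circ> T)"
    by (simp add: dom_subdiff_on_def subdiff_T)
  have nbhd: "(\<exists>U. open U \<and> T x \<in> U \<and> (\<forall>y \<in> U \<inter> range T. P y)) \<longleftrightarrow>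
      (\<exists>U. open U \<and> x \<in> U \<and> (\<forall>y \<in> U. P (T y)))" (is "?L \<longleftrightarrow> ?R") for P
  proof
    assume ?L
    then obtain U where U: "open U" "T x \<in> U" "\<forall>y \<in> U \<inter> range T. P y" by blast
    have "continuous_on UNIV T"
      using lin linear_continuous_on linear_linear by blast
    with U show ?R
      by (intro exI[of _ "T -` U"]) (auto intro: open_vimage)
  next
    assume ?R
    then obtain U e where U: "e > 0" "ball x e \<subseteq> U" "\<forall>y \<in> U. P (T y)"
      by (metis open_contains_ball)
    then have "\<forall>y \<in> ball (T x) e \<inter> range T. P y"
      by (auto simp: dist_norm norm_T_diff)
    with U show ?L
      by (intro exI[of _ "ball (T x) e"]) auto
  qed
  show ?thesis
    unfolding KL_half_at_on_def dom
    by (simp only: ex_simps nbhd d Int_UNIV_right comp_apply)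
qed

lemma KL_half_function_on_isometry:
  "KL_half_function_on (range T) \<phi> \<longleftrightarrow> KL_half_function_on UNIV (\<phi> \<circ> T)"
proof -
  have "dom_subdiff_on (range T) \<phi> = T ` dom_subdiff (\<phi> \<circ> T)"
    by (auto simp: dom_subdiff_on_def subdiff_T)
  then show ?thesis
    by (simp add: KL_half_function_on_def KL_half_at_T)
qed

end

end

(*
  Near a point xbar of the domain, lower semicontinuity of f + theta and the fact that the zero
  norm jumps by at least 1 force every x with Theta x < Theta xbar + nu/2 to have exactly the
  support I of xbar. On such points Theta differs from g_I by a constant, and projecting a
  subgradient of Theta onto the coordinates in I gives a subgradient of g_I of no larger norm.
  The KL inequality for g_I at xbar therefore transfers to Theta with the same constant c.
*)

theory Submission
  imports Defs
begin

section \<open>Supports, coordinate spaces and the projection onto them\<close>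

definition support :: "real ^ 'n \<Rightarrow> 'n set" where
  "support x = {i. x $ i \<noteq> 0}"

lemma l0_norm_eq_card_support: "l0_norm x = card (support x)"
  by (simp add: l0_norm_def support_def)

lemma mem_coord_space_iff_support: "x \<in> coord_space I \<longleftrightarrow> support x \<subseteq> I"
  by (auto simp: coord_space_def support_def)

lemma E_cols_eq_self: "x \<in> coord_space I \<Longrightarrow> E_cols I x = x"
  by (auto simp: coord_space_def E_cols_def vec_eq_iff)

lemma E_cols_mem_coord_space: "E_cols I v \<in> coord_space I"
  by (simp add: coord_space_def E_cols_def)

lemma norm_E_cols_le: "norm (E_cols I v) \<le> norm v"
  by (rule norm_le_componentwise_cart) (simp add: E_cols_def)

lemma continuous_on_E_cols: "continuous_on UNIV (E_cols I)"
proof -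
  have "continuous_on UNIV (\<lambda>v. if i \<in> I then v $ i else 0)" for i
    by (cases "i \<in> I") (auto intro!: continuous_intros)
  then show ?thesis
    unfolding E_cols_def by (intro continuous_on_vec_lambda)
qed

text \<open>On the ambient space \<open>E_cols I\<close> acts as the orthogonal projection onto
  \<open>coord_space I\<close>, so a vector and its projection give the same linear term in
  difference quotients taken inside that space.\<close>

lemma inner_E_cols:
  assumes "z \<in> coord_space I"
  shows "E_cols I v \<bullet> z = v \<bullet> z"
  unfolding inner_vec_def
  using assms by (intro sum.cong) (auto simp: coord_space_def E_cols_def)

text \<open>Each nonzero entry stays nonzero nearby, and there are finitely many entries. Only
  inclusion can be expected: zero entries may become nonzero.\<close>

lemma eventually_support_subset: "\<forall>\<^sub>F y in nhds x. support x \<subseteq> support y"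
proof -
  have "\<forall>\<^sub>F y in nhds x. y $ i \<noteq> 0" if "x $ i \<noteq> 0" for i
  proof -
    have "((\<lambda>y. y $ i) \<longlongrightarrow> x $ i) (nhds x)"
      by (intro tendsto_vec_nth filterlim_ident)
    then show ?thesis
      using that by (rule tendsto_imp_eventually_ne)
  qed
  then have "\<forall>\<^sub>F y in nhds x. \<forall>i. x $ i \<noteq> 0 \<longrightarrow> y $ i \<noteq> 0"
    by (intro eventually_all_finite) simp
  then show ?thesis
    by eventually_elim (auto simp: support_def)
qed

section \<open>Lower semicontinuity and local rigidity of the support\<close>

lemma lower_semicontinuous_real_add:
  fixes f :: "'a::euclidean_space \<Rightarrow> real" and \<theta> :: "'a \<Rightarrow> ereal"
  assumes f: "continuous_on UNIV f" and \<theta>: "lower_semicontinuous \<theta>"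
  shows "lower_semicontinuous (\<lambda>x. ereal (f x) + \<theta> x)"
  unfolding lower_semicontinuous_def le_Liminf_iff
proof (intro allI impI)
  fix x C
  assume C: "C < ereal (f x) + \<theta> x"
  then have "C - ereal (f x) < \<theta> x"
    by (cases C; cases "\<theta> x") auto
  \<comment> \<open>The real \<open>m\<close> splits the strict inequality: continuity controls
    \<open>f y + m\<close>, and lower semicontinuity keeps \<open>\<theta> y\<close> above
    \<open>m\<close>.\<close>
  then obtain m where m: "C - ereal (f x) < ereal m" "ereal m < \<theta> x"
    using ereal_dense2 by blast
  have "C < ereal (f x + m)"
    using m(1) by (cases C) auto
  moreover have "((\<lambda>y. ereal (f y + m)) \<longlongrightarrow> ereal (f x + m)) (at x)"
    using f by (auto intro!: tendsto_intros simp: continuous_on_def)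
  ultimately have "\<forall>\<^sub>F y in at x. C < ereal (f y + m)"
    by (rule order_tendstoD(1)[rotated])
  moreover have "ereal m < Liminf (at x) \<theta>"
    using m(2) \<theta> unfolding lower_semicontinuous_def by (blast intro: less_le_trans)
  then have "\<forall>\<^sub>F y in at x. ereal m < \<theta> y"
    by (rule less_LiminfD)
  ultimately show "\<forall>\<^sub>F y in at x. C < ereal (f y) + \<theta> y"
  proof eventually_elim
    case (elim y)
    then show ?case by (cases C; cases "\<theta> y") auto
  qed
qed

text \<open>Near \<open>x\<close> the support can only grow, and growth costs at least \<nu>, while
  \<open>g\<close> drops by less than \<nu>/2. A strictly larger support therefore leaves a net
  increase of more than \<nu>/2.\<close>

lemma eventually_support_eq:
  fixes g :: "real ^ 'n \<Rightarrow> ereal" and \<nu> :: real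
  assumes g: "lower_semicontinuous g" and x: "\<bar>g x\<bar> \<noteq> \<infinity>" and \<nu>: "\<nu> > 0"
  shows "\<forall>\<^sub>F y in nhds x.
    g y + ereal (\<nu> * real (l0_norm y)) < g x + ereal (\<nu> * real (l0_norm x)) + ereal (\<nu> / 2) \<longrightarrow>
    support y = support x"
proof -
  obtain r where r: "g x = ereal r"
    using x by auto
  have "ereal (r - \<nu> / 2) < g x"
    using r \<nu> by simp
  then have "ereal (r - \<nu> / 2) < Liminf (at x) g"
    using g unfolding lower_semicontinuous_def by (blast intro: less_le_trans)
  then have "\<forall>\<^sub>F y in at x. ereal (r - \<nu> / 2) < g y"
    by (rule less_LiminfD)
  \<comment> \<open>The bound also holds at \<open>x\<close> itself because
    \<open>g x = ereal r\<close> and \<nu> is positive.\<close>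
  then have "\<forall>\<^sub>F y in nhds x. ereal (r - \<nu> / 2) < g y"
    unfolding eventually_at_filter by eventually_elim (use r \<nu> in auto)
  with eventually_support_subset[of x] show ?thesis
  proof eventually_elim
    case (elim y)
    show ?case
    proof (intro impI, rule ccontr)
      assume less: "g y + ereal (\<nu> * real (l0_norm y)) < g x + ereal (\<nu> * real (l0_norm x)) + ereal (\<nu> / 2)"
        and "support y \<noteq> support x"
      with elim(1) have "support x \<subset> support y" by auto
      then have "l0_norm x + 1 \<le> l0_norm y"
        by (simp add: l0_norm_eq_card_support Suc_le_eq psubset_card_mono)
      then have "real (l0_norm x) + 1 \<le> real (l0_norm y)" by linarith
      then have "\<nu> * (real (l0_norm x) + 1) \<le> \<nu> * real (l0_norm y)"
        using \<nu> by (intro mult_left_mono) auto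
      then have "\<nu> * real (l0_norm x) + \<nu> \<le> \<nu> * real (l0_norm y)"
        by (simp add: algebra_simps)
      with less elim(2) r show False by (cases "g y") auto
    qed
  qed
qed

section \<open>Projecting subgradients onto the coordinate space of the support\<close>

text \<open>
  Works because the zero norm is constant near \<open>x\<close> within the coordinate space of its support.
\<close>

lemma E_cols_mem_rsubdiff_on:
  fixes g :: "real ^ 'n \<Rightarrow> ereal" and \<nu> :: real
  assumes v: "v \<in> rsubdiff_on UNIV (\<lambda>y. g y + ereal (\<nu> * real (l0_norm y))) x"
    and fin: "\<bar>g x\<bar> \<noteq> \<infinity>" and I: "support x = I"
  shows "E_cols I v \<in> rsubdiff_on (coord_space I) (\<lambda>z. g (E_cols I z)) x"
proof -
  let ?\<phi> = "\<lambda>y. g y + ereal (\<nu> * real (l0_norm y))"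
  let ?q = "\<lambda>x'. (?\<phi> x' - ?\<phi> x - ereal (v \<bullet> (x' - x))) / ereal (norm (x' - x))"
  let ?r = "\<lambda>z. (g (E_cols I z) - g (E_cols I x) - ereal (E_cols I v \<bullet> (z - x)))
    / ereal (norm (z - x))"
  have x: "x \<in> coord_space I"
    using I by (simp add: mem_coord_space_iff_support)
  have "\<forall>\<^sub>F z in at x within coord_space I. z \<in> coord_space I"
    by (simp add: eventually_at_filter)
  moreover have "\<forall>\<^sub>F z in at x within coord_space I. I \<subseteq> support z"
    using eventually_support_subset[of x] I
    by (auto simp: eventually_at_filter elim: eventually_mono)
  ultimately have "\<forall>\<^sub>F z in at x within coord_space I. ?q z \<le> ?r z"
  proof eventually_elim
    case (elim z)
    then have "support z = support x"
      using I by (auto simp: mem_coord_space_iff_support)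
    then have l0: "l0_norm z = l0_norm x"
      by (simp add: l0_norm_eq_card_support)
    have "z - x \<in> coord_space I"
      using elim x by (simp add: coord_space_def)
    then have "E_cols I v \<bullet> (z - x) = v \<bullet> (z - x)"
      by (rule inner_E_cols)
    \<comment> \<open>The zero-norm terms cancel; finiteness of \<open>g x\<close> makes this valid
      even where \<open>g z\<close> is infinite.\<close>
    moreover have "?\<phi> z - ?\<phi> x = g z - g x"
      using fin l0 by (cases "g z"; cases "g x") auto
    ultimately show ?case
      using elim x by (simp add: E_cols_eq_self)
  qed
  then have "Liminf (at x within coord_space I) ?q \<le> Liminf (at x within coord_space I) ?r"
    by (rule Liminf_mono)
  \<comment> \<open>Restricting to a subspace gives a finer filter, which can only raise the lower
    limit.\<close>
  moreover have "Liminf (at x) ?q \<le> Liminf (at x within coord_space I) ?q"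
    unfolding Liminf_def
    by (rule SUP_subset_mono) (auto intro: filter_leD[OF at_le])
  moreover have "0 \<le> Liminf (at x) ?q"
    using v by (simp add: rsubdiff_on_def split: if_splits)
  ultimately show ?thesis
    using x fin by (auto simp: rsubdiff_on_def effdom_on_def E_cols_eq_self E_cols_mem_coord_space)
qed

text \<open>Convergence of the function values forces the approximating points to have support
  \<open>I\<close> eventually. There the result for regular subgradients applies termwise, and
  continuity of the projection carries it to the limit.\<close>

lemma E_cols_mem_subdiff_on:
  fixes g :: "real ^ 'n \<Rightarrow> ereal" and \<nu> :: real
  assumes v: "v \<in> subdiff (\<lambda>y. g y + ereal (\<nu> * real (l0_norm y))) x"
    and g: "lower_semicontinuous g" "\<And>y. g y \<noteq> -\<infinity>" and \<nu>: "\<nu> > 0" and I: "support x = I"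
  shows "E_cols I v \<in> subdiff_on (coord_space I) (\<lambda>z. g (E_cols I z)) x"
proof -
  let ?\<phi> = "\<lambda>y. g y + ereal (\<nu> * real (l0_norm y))"
  from v have "?\<phi> x < \<infinity>"
    by (auto simp: subdiff_on_def effdom_on_def split: if_splits)
  then have fin: "\<bar>g x\<bar> \<noteq> \<infinity>"
    using g(2)[of x] by (cases "g x") auto
  from v obtain X V where XV: "\<And>k::nat. V k \<in> rsubdiff_on UNIV ?\<phi> (X k)"
    "X \<longlonglongrightarrow> x" "(\<lambda>k. ?\<phi> (X k)) \<longlonglongrightarrow> ?\<phi> x" "V \<longlonglongrightarrow> v"
    by (auto simp: subdiff_on_def split: if_splits)
  have "?\<phi> x < ?\<phi> x + ereal (\<nu> / 2)"
    using fin \<nu> by auto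
  then have "\<forall>\<^sub>F k in sequentially. ?\<phi> (X k) < ?\<phi> x + ereal (\<nu> / 2)"
    by (rule order_tendstoD(2)[OF XV(3)])
  moreover have "\<forall>\<^sub>F k in sequentially. ?\<phi> (X k) < ?\<phi> x + ereal (\<nu> / 2) \<longrightarrow> support (X k) = support x"
    using eventually_support_eq[OF g(1) fin \<nu>] XV(2) by (rule eventually_compose_filterlim)
  ultimately have "\<forall>\<^sub>F k in sequentially. support (X k) = I"
    by eventually_elim (simp add: I)
  then obtain N where N: "\<And>k. k \<ge> N \<Longrightarrow> support (X k) = I"
    by (auto simp: eventually_sequentially)
  \<comment> \<open>\<open>subdiff_on\<close> asks for membership at every index, so the initial
    segment is dropped.\<close>
  define Y W where "Y = (\<lambda>k. X (k + N))" and "W = (\<lambda>k. E_cols I (V (k + N)))"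
  have supp: "support (Y k) = I" for k
    using N by (simp add: Y_def)
  then have Y: "Y k \<in> coord_space I" for k
    by (simp add: mem_coord_space_iff_support)
  have x: "x \<in> coord_space I"
    using I by (simp add: mem_coord_space_iff_support)
  have "W k \<in> rsubdiff_on (coord_space I) (\<lambda>z. g (E_cols I z)) (Y k)" for k
  proof -
    have "?\<phi> (Y k) < \<infinity>"
      using XV(1)[of "k + N"] by (auto simp: Y_def rsubdiff_on_def effdom_on_def split: if_splits)
    then have "\<bar>g (Y k)\<bar> \<noteq> \<infinity>"
      using g(2)[of "Y k"] by (cases "g (Y k)") auto
    then show ?thesis
      using XV(1)[of "k + N"] supp[of k] unfolding W_def Y_def by (intro E_cols_mem_rsubdiff_on)
  qed
  moreover have "Y \<longlonglongrightarrow> x"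
    unfolding Y_def using XV(2) by (rule LIMSEQ_ignore_initial_segment)
  moreover have "W \<longlonglongrightarrow> E_cols I v"
    unfolding W_def
    using continuous_on_tendsto_compose[OF continuous_on_E_cols LIMSEQ_ignore_initial_segment[OF XV(4)]]
    by simp
  moreover have "(\<lambda>k. g (E_cols I (Y k))) \<longlonglongrightarrow> g (E_cols I x)"
  proof -
    \<comment> \<open>On the tail the zero norm equals that of \<open>x\<close>; removing this
      finite constant turns convergence of \<open>?\<phi>\<close> into convergence of
      \<open>g\<close>.\<close>
    have "(\<lambda>k. ?\<phi> (Y k) + ereal (- \<nu> * real (l0_norm x))) \<longlonglongrightarrow> ?\<phi> x + ereal (- \<nu> * real (l0_norm x))"
      unfolding Y_def using LIMSEQ_ignore_initial_segment[OF XV(3)]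
      by (intro tendsto_cadd_ereal) (simp_all add: g(2))
    moreover have "?\<phi> z + ereal (- \<nu> * real (l0_norm x)) = g (E_cols I z)" if "support z = I" for z
      using that I
      by (cases "g z") (simp_all add: l0_norm_eq_card_support E_cols_eq_self mem_coord_space_iff_support)
    ultimately show ?thesis
      using supp I by simp
  qed
  ultimately have "\<exists>Y W. (\<forall>k::nat. Y k \<in> coord_space I \<and>
      W k \<in> rsubdiff_on (coord_space I) (\<lambda>z. g (E_cols I z)) (Y k)) \<and>
      Y \<longlonglongrightarrow> x \<and> (\<lambda>k. g (E_cols I (Y k))) \<longlonglongrightarrow> g (E_cols I x) \<and> W \<longlonglongrightarrow> E_cols I v"
    using Y by blast
  then show ?thesis
    using x fin by (auto simp: subdiff_on_def effdom_on_def E_cols_eq_self E_cols_mem_coord_space)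
qed

section \<open>Transfer of the KL inequality\<close>

lemma edist0_image_le:
  assumes "\<And>v. v \<in> A \<Longrightarrow> P v \<in> B" "\<And>v. norm (P v) \<le> norm v"
  shows "edist0 B \<le> edist0 A"
  unfolding edist0_def
  using assms by (intro INF_mono) auto

text \<open>The sign is what allows an inequality between extended-real distances to be multiplied
  by this factor.\<close>

lemma deriv_sqrt_nonneg:
  assumes "c > 0" "t > 0"
  shows "0 \<le> deriv (\<lambda>s::real. c * sqrt s) t"
proof -
  have "((\<lambda>s. c * sqrt s) has_real_derivative c * (inverse (sqrt t) / 2)) (at t)"
    using assms by (intro DERIV_cmult DERIV_real_sqrt)
  then show ?thesis
    using assms by (simp add: DERIV_imp_deriv)
qed

text \<open>Here \<open>g\<close> plays the role of f + \<theta>. Shrinking the neighborhood and the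
  range of values leaves only points with the support of \<open>x\<close> to test; there the
  increments of both functions agree and projected subgradients are no longer than the
  originals.\<close>

lemma KL_half_at_add_l0_norm:
  fixes g :: "real ^ 'n \<Rightarrow> ereal" and \<nu> :: real
  assumes g: "lower_semicontinuous g" "\<And>y. g y \<noteq> -\<infinity>" and \<nu>: "\<nu> > 0"
    and dom: "x \<in> dom_subdiff (\<lambda>y. g y + ereal (\<nu> * real (l0_norm y)))"
    and KL: "KL_half_function_on (coord_space (support x)) (\<lambda>z. g (E_cols (support x) z))"
  shows "KL_half_at (\<lambda>y. g y + ereal (\<nu> * real (l0_norm y))) x"
proof -
  let ?\<phi> = "\<lambda>y. g y + ereal (\<nu> * real (l0_norm y))"
  define I where "I = support x"
  let ?g = "\<lambda>z. g (E_cols I z)"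
  obtain v where v: "v \<in> subdiff ?\<phi> x"
    using dom by (auto simp: dom_subdiff_on_def)
  then have "?\<phi> x < \<infinity>"
    by (auto simp: subdiff_on_def effdom_on_def split: if_splits)
  then have fin: "\<bar>g x\<bar> \<noteq> \<infinity>"
    using g(2)[of x] by (cases "g x") auto
  have x: "x \<in> coord_space I"
    by (simp add: I_def mem_coord_space_iff_support)
  \<comment> \<open>This puts \<open>x\<close> in the domain of the subdifferential of
    \<open>?g\<close>, where the KL hypothesis provides an inequality.\<close>
  have "E_cols I v \<in> subdiff_on (coord_space I) ?g x"
    using v g \<nu> by (rule E_cols_mem_subdiff_on) (simp add: I_def)
  then have "x \<in> dom_subdiff_on (coord_space I) ?g"
    using x by (auto simp: dom_subdiff_on_def)
  then have "KL_half_at_on (coord_space I) ?g x"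
    using KL by (simp add: KL_half_function_on_def I_def)
  then obtain c \<eta> U where c: "c > 0" and \<eta>: "\<eta> > 0" and U: "open U" "x \<in> U" and
    ineq: "\<And>y. y \<in> U \<inter> coord_space I \<Longrightarrow> ?g x < ?g y \<Longrightarrow> ?g y < ?g x + \<eta> \<Longrightarrow>
      ereal (deriv (\<lambda>s::real. c * sqrt s) (real_of_ereal (?g y - ?g x)))
        * edist0 (subdiff_on (coord_space I) ?g y) \<ge> 1"
    unfolding KL_half_at_on_def by blast
  obtain U' where U': "open U'" "x \<in> U'"
    "\<And>y. y \<in> U' \<Longrightarrow> ?\<phi> y < ?\<phi> x + ereal (\<nu> / 2) \<Longrightarrow> support y = I"
    using eventually_support_eq[OF g(1) fin \<nu>] unfolding eventually_nhds I_def by blast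
  \<comment> \<open>The cap \<nu>/2 is the threshold below which \<open>U'\<close> fixes the
    support.\<close>
  define \<eta>' where "\<eta>' = min \<eta> (ereal (\<nu> / 2))"
  have "ereal (deriv (\<lambda>s::real. c * sqrt s) (real_of_ereal (?\<phi> y - ?\<phi> x)))
      * edist0 (subdiff ?\<phi> y) \<ge> 1"
    if y: "y \<in> U \<inter> U'" "?\<phi> x < ?\<phi> y" "?\<phi> y < ?\<phi> x + \<eta>'" for y
  proof -
    have "?\<phi> y < ?\<phi> x + ereal (\<nu> / 2)" and y\<eta>: "?\<phi> y < ?\<phi> x + \<eta>"
      using y(3) add_left_mono[of \<eta>' "ereal (\<nu> / 2)" "?\<phi> x"] add_left_mono[of \<eta>' \<eta> "?\<phi> x"]
      by (auto simp: \<eta>'_def intro: less_le_trans)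
    then have supp: "support y = I"
      using U'(3) y(1) by blast
    then have yI: "y \<in> coord_space I"
      by (simp add: mem_coord_space_iff_support)
    have l0: "l0_norm y = l0_norm x"
      using supp by (simp add: I_def l0_norm_eq_card_support)
    have finy: "\<bar>g y\<bar> \<noteq> \<infinity>"
      using y(3) y\<eta> \<open>?\<phi> y < ?\<phi> x + ereal (\<nu> / 2)\<close> g(2)[of y] fin by (cases "g y") auto
    \<comment> \<open>Equal zero norms cancel, so the derivative is evaluated at the same argument
      for both functions.\<close>
    have diff: "?\<phi> y - ?\<phi> x = ?g y - ?g x"
      using fin finy x yI l0 by (auto simp: E_cols_eq_self)
    have lt: "?g x < ?g y"
      using y(2) fin finy x yI l0 by (auto simp: E_cols_eq_self)
    have lt\<eta>: "?g y < ?g x + \<eta>"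
      using y\<eta> fin finy x yI l0 by (cases \<eta>) (auto simp: E_cols_eq_self)
    have "real_of_ereal (?g y - ?g x) > 0"
      using lt fin finy x yI by (auto simp: E_cols_eq_self)
    then have pos: "0 \<le> ereal (deriv (\<lambda>s::real. c * sqrt s) (real_of_ereal (?g y - ?g x)))"
      using c by (simp add: deriv_sqrt_nonneg)
    \<comment> \<open>If \<open>subdiff ?\<phi> y\<close> is empty, the right-hand side is infinite
      and the bound still holds.\<close>
    have "edist0 (subdiff_on (coord_space I) ?g y) \<le> edist0 (subdiff ?\<phi> y)"
      by (rule edist0_image_le[of _ "E_cols I"])
        (use g \<nu> supp in \<open>auto intro: E_cols_mem_subdiff_on norm_E_cols_le\<close>)
    then show ?thesis
      unfolding diff using ineq[of y] y(1) yI lt lt\<eta> pos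
      by (meson IntD1 IntI ereal_mult_left_mono order_trans)
  qed
  moreover have "\<eta>' > 0" "open (U \<inter> U')" "x \<in> U \<inter> U'"
    using \<eta> \<nu> U U'(1,2) by (auto simp: \<eta>'_def)
  ultimately show ?thesis
    unfolding KL_half_at_on_def Int_UNIV_right using dom c
    by (intro conjI exI[of _ c] exI[of _ \<eta>'] exI[of _ "U \<inter> U'"]) blast+
qed

lemma continuously_differentiable_imp_continuous_on:
  "continuously_differentiable f \<Longrightarrow> continuous_on UNIV f"
  unfolding continuously_differentiable_def gderiv_def
  by (metis has_derivative_continuous continuous_at_imp_continuous_on)

theorem theorem4p1:
  fixes f :: "real ^ 'n \<Rightarrow> real"
    and \<theta> :: "real ^ 'n \<Rightarrow> ereal"
    and \<nu> :: real
    and h :: "real ^ 'n \<Rightarrow> ereal"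
    and \<Theta> :: "real ^ 'n \<Rightarrow> ereal"
  defines "h \<equiv> \<lambda>x. ereal (\<nu> * real (l0_norm x))"
    and "\<Theta> \<equiv> \<lambda>x. ereal (f x) + \<theta> x + h x"
  assumes "continuously_differentiable f"
    and "proper \<theta>"
    and "lower_semicontinuous \<theta>"
    and "\<nu> > 0"
    and "continuous_on (dom_subdiff \<theta>) \<theta>"
    and "\<forall>x \<in> dom_subdiff \<theta>. subdiff_regular_at \<theta> x"
    and "\<forall>x \<in> dom_subdiff \<theta>.
           subdiff (\<lambda>y. \<theta> y + h y) x \<subseteq> {u + v | u v. u \<in> subdiff \<theta> x \<and> v \<in> subdiff h x}"
    and "\<forall>I :: 'n set.
           KL_half_function_on (coord_space I) (\<lambda>z. ereal (f (E_cols I z)) + \<theta> (E_cols I z))"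
  shows "\<forall>xbar. critical_point \<Theta> xbar \<longrightarrow> KL_half_at \<Theta> xbar"
proof (intro allI impI)
  fix xbar
  assume crit: "critical_point \<Theta> xbar"
  \<comment> \<open>Regrouping makes f + \<theta> the single function \<open>g\<close> of the
    transfer lemma.\<close>
  have \<Theta>: "\<Theta> = (\<lambda>y. (ereal (f y) + \<theta> y) + ereal (\<nu> * real (l0_norm y)))"
    by (simp add: \<Theta>_def h_def)
  have "xbar \<in> dom_subdiff \<Theta>"
    using crit by (auto simp: critical_point_def dom_subdiff_on_def)
  moreover have "lower_semicontinuous (\<lambda>y. ereal (f y) + \<theta> y)"
    using assms by (intro lower_semicontinuous_real_add continuously_differentiable_imp_continuous_on)
  moreover have "ereal (f y) + \<theta> y \<noteq> -\<infinity>" for y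
    using \<open>proper \<theta>\<close> by (simp add: proper_def)
  ultimately show "KL_half_at \<Theta> xbar"
    using assms(6,10) unfolding \<Theta> by (intro KL_half_at_add_l0_norm) auto
qed

end
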